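(* Let $\mathfrak{B}\subseteq[0,1]$ be a fractal microstructure with $\sigma$-finite development $\{\mathfrak{B}_n : n\ge 0\}$, let $F\in L^2(0,1)$, $\beta>0$ a constant, and $f:\mathfrak{B}\to\mathbb{R}$. For each $n$ consider the problem: find $p_n\in V$ such that $$\int_0^1 p_n'\,q' + \beta\sum_{b\in\mathfrak{B}_n}p_n(b)\,q(b)=\int_0^1 F\,q+\sum_{b\in\mathfrak{B}_n}f(b)\,q(b)\qquad\text{for all } q\in V .$$ This problem is well-posed. Moreover, if $f\in\ell^2(\mathfrak{B})$, then the sequence of solutions $\{p_n : n\in\mathbb{N}\}$ is bounded in $V$, and for each $n\in\mathbb{N}$ both $$\|p_n\|_V\le \frac{1}{\min\{1,\beta\}}\Big(\|F\|_{L^2(0,1)}^2+\|f\|_{\ell^2(\mathfrak{B})}^2\Big)^{1/2}$$ and $$\Big(\sum_{b\in\mathfrak{B}_n}p_n^2(b)\Big)^{1/2}\le \frac{1}{\min\{1,\beta\}}\Big(\|F\|_{L^2(0,1)}^2+\|f\|_{\ell^2(\mathfrak{B})}^2\Big)^{1/2}.$$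
   Context: Fractal microstructure: a countable set $\mathfrak{B}\subseteq[0,1]$ for which there exist a sequence of finite subsets $\{\mathfrak{B}_n:n\ge 0\}$ and finitely many similarities $S_1,\dots,S_L:[0,1]\to[0,1]$, $L\ge 2$ (each satisfying $|S_i(x)-S_i(y)|=c_i|x-y|$ for all $x,y$, with $c_i\in[0,1)$), such that $\mathfrak{B}_n=\bigcup_{i=1}^L S_i(\mathfrak{B}_{n-1})$ for all $n\ge1$, and $\mathfrak{B}_n$ is monotonically increasing in $n$ with $\bigcup_n\mathfrak{B}_n=\mathfrak{B}$. Such a sequence $\{\mathfrak{B}_n\}$ is called a $\sigma$-finite development of $\mathfrak{B}$. $\ell^2(\mathfrak{B})=\{g:\mathfrak{B}\to\mathbb{R} : \sum_{b\in\mathfrak{B}}|g(b)|^2<\infty\}$ with norm $\|g\|_{\ell^2(\mathfrak{B})}=(\sum_{b}|g(b)|^2)^{1/2}$. $V=\{u\in H^1(0,1): u(0)=0\}$ with inner product $\langle u,v\rangle_V=\int_0^1 u'v'$ and norm $\|u\|_V=\langle u,u\rangle_V^{1/2}$; $u'$ is the weak derivative, and elements of $H^1(0,1)$ are identified with their continuous representatives on $[0,1]$. Well-posed (Hadamard sense): for all data there is exactly one solution, and it depends continuously on the data (here $F\in L^2(0,1)$ and $f|_{\mathfrak{B}_n}\in\mathbb{R}^{\mathfrak{B}_n}$). *)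

theory Defs
  imports "HOL-Analysis.Analysis"
begin

section \<open>Fractal microstructures\<close>

definition contractive_similarity :: "(real \<Rightarrow> real) \<Rightarrow> bool" where
  "contractive_similarity S \<longleftrightarrow>
     S \<in> {0..1} \<rightarrow> {0..1} \<and>
     (\<exists>c. 0 \<le> c \<and> c < 1 \<and> (\<forall>x\<in>{0..1}. \<forall>y\<in>{0..1}. \<bar>S x - S y\<bar> = c * \<bar>x - y\<bar>))"

definition sigma_finite_development :: "real set \<Rightarrow> (nat \<Rightarrow> real set) \<Rightarrow> bool" where
  "sigma_finite_development B Bn \<longleftrightarrow>
     (\<forall>n. finite (Bn n) \<and> Bn n \<subseteq> B) \<and>
     (\<exists>(L::nat) S. 2 \<le> L \<and> (\<forall>i\<in>{1..L}. contractive_similarity (S i)) \<and>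
        (\<forall>n\<ge>1. Bn n = (\<Union>i\<in>{1..L}. S i ` Bn (n - 1)))) \<and>
     incseq Bn \<and> (\<Union>n. Bn n) = B"

definition fractal_microstructure :: "real set \<Rightarrow> bool" where
  "fractal_microstructure B \<longleftrightarrow>
     countable B \<and> B \<subseteq> {0..1} \<and> (\<exists>Bn. sigma_finite_development B Bn)"

text \<open>Only the values on \<open>B\<close> of a function \<open>g :: real \<Rightarrow> real\<close> matter here: it stands for
  its restriction to \<open>B\<close>.\<close>

definition ell2 :: "real set \<Rightarrow> (real \<Rightarrow> real) set" where
  "ell2 B = {g. (\<lambda>b. \<bar>g b\<bar>\<^sup>2) summable_on B}"

definition norm_ell2 :: "real set \<Rightarrow> (real \<Rightarrow> real) \<Rightarrow> real" where
  "norm_ell2 B g = sqrt (\<Sum>\<^sub>\<infinity>b\<in>B. \<bar>g b\<bar>\<^sup>2)"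

section \<open>Function spaces on the unit interval\<close>

abbreviation unit_measure :: "real measure" where
  "unit_measure \<equiv> lebesgue_on {0<..<1}"

text \<open>Elements of \<open>L\<^sup>2(0,1)\<close> are given by representatives; functions equal almost everywhere
  on \<open>(0,1)\<close> are not identified, and \<open>norm_L2\<close> is a seminorm on representatives.\<close>

definition L2 :: "(real \<Rightarrow> real) set" where
  "L2 = {u. u \<in> borel_measurable unit_measure \<and> integrable unit_measure (\<lambda>x. (u x)\<^sup>2)}"

definition norm_L2 :: "(real \<Rightarrow> real) \<Rightarrow> real" where
  "norm_L2 u = sqrt (\<integral>x. (u x)\<^sup>2 \<partial>unit_measure)"

text \<open>\<open>C\<^sub>c\<^sup>\<infinity>(0,1)\<close>, each function being extended by zero to the real line.\<close>

definition test_functions :: "(real \<Rightarrow> real) set" where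
  "test_functions =
     {\<phi>. (\<forall>k. (deriv ^^ k) \<phi> differentiable_on UNIV) \<and>
         compact (closure {x. \<phi> x \<noteq> 0}) \<and> closure {x. \<phi> x \<noteq> 0} \<subseteq> {0<..<1}}"

definition has_L2_weak_deriv :: "(real \<Rightarrow> real) \<Rightarrow> (real \<Rightarrow> real) \<Rightarrow> bool" where
  "has_L2_weak_deriv u g \<longleftrightarrow> u \<in> L2 \<and> g \<in> L2 \<and>
     (\<forall>\<phi>\<in>test_functions.
        (\<integral>x. u x * deriv \<phi> x \<partial>unit_measure) = - (\<integral>x. g x * \<phi> x \<partial>unit_measure))"

definition H1 :: "(real \<Rightarrow> real) set" where
  "H1 = {u. \<exists>g. has_L2_weak_deriv u g}"

text \<open>The weak derivative is determined only up to a null set, so this is one representative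
  of it; it is used exclusively under integrals.\<close>

definition weak_deriv :: "(real \<Rightarrow> real) \<Rightarrow> real \<Rightarrow> real" where
  "weak_deriv u = (SOME g. has_L2_weak_deriv u g)"

text \<open>Membership requires the representative that is continuous on \<open>[0,1]\<close>. The value 0 outside
  \<open>[0,1]\<close> is a convention, so that functions on \<open>[0,1]\<close> correspond to unique functions on the
  real line and \<open>V\<close> is closed under pointwise linear combinations.\<close>

definition V :: "(real \<Rightarrow> real) set" where
  "V = {u \<in> H1. continuous_on {0..1} u \<and> (\<forall>x. x \<notin> {0..1} \<longrightarrow> u x = 0) \<and> u 0 = 0}"

definition inner_V :: "(real \<Rightarrow> real) \<Rightarrow> (real \<Rightarrow> real) \<Rightarrow> real" where
  "inner_V u v = (\<integral>x. weak_deriv u x * weak_deriv v x \<partial>unit_measure)"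

definition norm_V :: "(real \<Rightarrow> real) \<Rightarrow> real" where
  "norm_V u = sqrt (inner_V u u)"

section \<open>The variational problem\<close>

definition is_solution ::
  "real \<Rightarrow> real set \<Rightarrow> (real \<Rightarrow> real) \<times> (real \<Rightarrow> real) \<Rightarrow> (real \<Rightarrow> real) \<Rightarrow> bool" where
  "is_solution \<beta> A = (\<lambda>(F, f) p. p \<in> V \<and>
     (\<forall>q\<in>V. inner_V p q + \<beta> * (\<Sum>b\<in>A. p b * q b) =
        (\<integral>x. F x * q x \<partial>unit_measure) + (\<Sum>b\<in>A. f b * q b)))"

text \<open>Hadamard well-posedness of a problem with data set \<open>D\<close>, (pseudo-)distance \<open>dD\<close> on the data,
  solution relation \<open>sol\<close> and distance \<open>dY\<close> on the solutions.\<close>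

definition hadamard_well_posed ::
  "'d set \<Rightarrow> ('d \<Rightarrow> 'd \<Rightarrow> real) \<Rightarrow> ('d \<Rightarrow> 'y \<Rightarrow> bool) \<Rightarrow> ('y \<Rightarrow> 'y \<Rightarrow> real) \<Rightarrow> bool" where
  "hadamard_well_posed D dD sol dY \<longleftrightarrow>
     (\<forall>d\<in>D. \<exists>!y. sol d y) \<and>
     (\<forall>d\<in>D. \<forall>y. sol d y \<longrightarrow>
        (\<forall>\<epsilon>>0. \<exists>\<delta>>0. \<forall>d'\<in>D. \<forall>y'. sol d' y' \<longrightarrow> dD d d' < \<delta> \<longrightarrow> dY y y' < \<epsilon>))"

text \<open>Distance on \<open>L\<^sup>2(0,1) \<times> \<real>\<^sup>A\<close> for finite \<open>A\<close>; the second component of a datum enters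
  only through its restriction to \<open>A\<close>.\<close>

definition data_dist ::
  "real set \<Rightarrow> (real \<Rightarrow> real) \<times> (real \<Rightarrow> real) \<Rightarrow> (real \<Rightarrow> real) \<times> (real \<Rightarrow> real) \<Rightarrow> real" where
  "data_dist A = (\<lambda>(F, f) (G, g).
     sqrt ((norm_L2 (\<lambda>x. F x - G x))\<^sup>2 + (\<Sum>b\<in>A. (f b - g b)\<^sup>2)))"

definition well_posed_problem :: "real \<Rightarrow> real set \<Rightarrow> bool" where
  "well_posed_problem \<beta> A \<longleftrightarrow>
     hadamard_well_posed (L2 \<times> UNIV) (data_dist A) (is_solution \<beta> A)
       (\<lambda>p r. norm_V (\<lambda>x. p x - r x))"

end

theory Submission
  imports Defs
begin

text \<open>
The whole argument rests on one identification: \<open>V\<close> is exactly the set of primitives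
\<open>x \<mapsto> \<integral>\<^sub>0\<^sup>x g\<close> of functions \<open>g\<close> in \<open>L\<^sup>2(0,1)\<close>, and \<open>g\<close> is then the weak derivative up to
a null set (\<open>V_eq_primitives\<close>, \<open>weak_deriv_primitive\<close>). That a primitive has the expected weak
derivative is Fubini's theorem on a triangle. Conversely, if \<open>u\<close> in \<open>V\<close> has weak derivative \<open>g\<close>, then
\<open>u\<close> minus the primitive of \<open>g\<close> is a continuous function annihilating all derivatives of test
functions, so it is constant by the lemma of du Bois-Reymond, and it vanishes at 0. This turns the
inner product of \<open>V\<close> into the one of \<open>L\<^sup>2(0,1)\<close>, and point evaluation at \<open>b\<close> into the pairing with the
indicator function of \<open>(0,b)\<close>.

Existence of solutions is then elementary. By Fubini, the right-hand side of the problem is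
\<open>q \<mapsto> \<integral> G q'\<close> for some \<open>G\<close> in \<open>L\<^sup>2(0,1)\<close>. Without penalised points, \<open>p' = G\<close> is a solution. Each
further point changes the bilinear form by a symmetric rank-one term, so that a solution for one
more point arises from two solutions for the smaller set, as in the Sherman-Morrison formula
(\<open>point_penalty_solvable\<close>).

The bounds come from testing with \<open>q = p\<close>. With \<open>m = min 1 \<beta>\<close> and
\<open>X = \<parallel>p\<parallel>\<^sub>V\<^sup>2 + \<Sum> p(b)\<^sup>2\<close>, the left-hand side is at least \<open>m X\<close>, while Young's inequality
\<open>2 m x y \<le> x\<^sup>2 + m\<^sup>2 y\<^sup>2\<close> and the Poincare inequality \<open>\<parallel>p\<parallel>\<^sub>L\<^sub>2 \<le> \<parallel>p\<parallel>\<^sub>V\<close> bound \<open>2 m\<close> times the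
right-hand side by \<open>\<parallel>F\<parallel>\<^sup>2 + \<Sum> f(b)\<^sup>2 + m\<^sup>2 X\<close>. Hence \<open>m\<^sup>2 X \<le> \<parallel>F\<parallel>\<^sup>2 + \<Sum> f(b)\<^sup>2\<close>
(\<open>energy_estimate\<close>). Since the sum over \<open>Bn n\<close> is at most the squared norm of \<open>f\<close> in
\<open>\<ell>\<^sup>2(B)\<close>, this gives both claimed bounds, uniformly in \<open>n\<close>. Applied to the difference of two
solutions, which solves the problem with the difference of the data, the same estimate gives
uniqueness and continuous dependence.
\<close>

section \<open>Square-integrable functions on the unit interval\<close>

lemma finite_unit_measure: "finite_measure unit_measure"
  by (intro finite_measure_lebesgue_on) auto

lemma integral_unit_measure_const: "(\<integral>x. (c::real) \<partial>unit_measure) = c"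
  by (simp add: measure_restrict_space)

lemma integrable_bounded_unit:
  assumes "f \<in> borel_measurable unit_measure" "\<And>x. x \<in> {0<..<1} \<Longrightarrow> \<bar>f x\<bar> \<le> (C::real)"
  shows "integrable unit_measure f"
proof -
  interpret finite_measure unit_measure by (rule finite_unit_measure)
  show ?thesis
    by (rule integrable_const_bound[where B = C]) (use assms in auto)
qed

lemma L2_bounded:
  assumes "f \<in> borel_measurable unit_measure" "\<And>x. x \<in> {0<..<1} \<Longrightarrow> \<bar>f x\<bar> \<le> (C::real)"
  shows "f \<in> L2"
proof -
  have "integrable unit_measure (\<lambda>x. (f x)\<^sup>2)"
  proof (rule integrable_bounded_unit[where C = "C\<^sup>2"])
    show "\<bar>(f x)\<^sup>2\<bar> \<le> C\<^sup>2" if "x \<in> {0<..<1}" for x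
      using assms(2)[OF that] power_mono[of "\<bar>f x\<bar>" C 2] by simp
  qed (use assms(1) in measurable)
  then show ?thesis using assms(1) by (simp add: L2_def)
qed

lemma L2_measurable: "f \<in> L2 \<Longrightarrow> f \<in> borel_measurable unit_measure"
  by (simp add: L2_def)

lemma L2_integrable_mult:
  assumes "f \<in> L2" "g \<in> L2"
  shows "integrable unit_measure (\<lambda>x. f x * g x)"
proof (rule Bochner_Integration.integrable_bound)
  show "integrable unit_measure (\<lambda>x. (f x)\<^sup>2 + (g x)\<^sup>2)"
    using assms by (auto simp: L2_def)
  show "(\<lambda>x. f x * g x) \<in> borel_measurable unit_measure"
    using assms by (auto simp: L2_def)
  have "\<bar>a * b\<bar> \<le> a\<^sup>2 + b\<^sup>2" for a b :: real
  proof -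
    have "2 * (\<bar>a\<bar> * \<bar>b\<bar>) \<le> a\<^sup>2 + b\<^sup>2"
      using zero_le_power2[of "\<bar>a\<bar> - \<bar>b\<bar>"] by (simp add: power2_diff)
    then show ?thesis by (simp add: abs_mult) (smt (verit) mult_nonneg_nonneg abs_ge_zero)
  qed
  then show "AE x in unit_measure. norm (f x * g x) \<le> norm ((f x)\<^sup>2 + (g x)\<^sup>2)"
    by (intro AE_I2) auto
qed

lemma L2_const: "(\<lambda>x. c) \<in> L2"
  by (rule L2_bounded[where C = "\<bar>c\<bar>"]) auto

lemma L2_integrable: "f \<in> L2 \<Longrightarrow> integrable unit_measure f"
  using L2_integrable_mult[OF _ L2_const[of 1]] by simp

lemma L2_add: "f \<in> L2 \<Longrightarrow> g \<in> L2 \<Longrightarrow> (\<lambda>x. f x + g x) \<in> L2"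
  using L2_integrable_mult[of f g] by (auto simp: L2_def power2_sum mult.assoc)

lemma L2_cmult: "f \<in> L2 \<Longrightarrow> (\<lambda>x. c * f x) \<in> L2"
  by (auto simp: L2_def power_mult_distrib)

lemma L2_diff: "f \<in> L2 \<Longrightarrow> g \<in> L2 \<Longrightarrow> (\<lambda>x. f x - g x) \<in> L2"
  using L2_add[of f "\<lambda>x. (-1) * g x"] L2_cmult[of g "-1"] by simp

lemma ident_measurable_unit: "(\<lambda>x::real. x) \<in> borel_measurable unit_measure"
  by (rule continuous_imp_measurable_on_sets_lebesgue) simp_all

lemma indicator_measurable_unit:
  "S \<in> sets borel \<Longrightarrow> (indicator S :: real \<Rightarrow> real) \<in> borel_measurable unit_measure"
  using measurable_compose[OF ident_measurable_unit borel_measurable_indicator, of S] by simp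

lemma L2_indicator_mult:
  assumes "S \<in> sets borel" "f \<in> L2"
  shows "(\<lambda>x. indicator S x * f x) \<in> L2"
proof -
  have meas: "(\<lambda>x. indicator S x * f x) \<in> borel_measurable unit_measure"
    by (intro borel_measurable_times indicator_measurable_unit L2_measurable assms)
  have "integrable unit_measure (\<lambda>x. (indicator S x * f x)\<^sup>2)"
  proof (rule Bochner_Integration.integrable_bound)
    show "integrable unit_measure (\<lambda>x. (f x)\<^sup>2)" using assms by (simp add: L2_def)
    show "(\<lambda>x. (indicator S x * f x)\<^sup>2) \<in> borel_measurable unit_measure"
      by (rule borel_measurable_power[OF meas])
  qed (auto simp: indicator_def)
  then show ?thesis
    using meas by (simp add: L2_def)
qed

lemma L2_indicator: "S \<in> sets borel \<Longrightarrow> (indicator S :: real \<Rightarrow> real) \<in> L2"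
  using L2_indicator_mult[OF _ L2_const[of 1]] by simp

lemma continuous_on_measurable_unit:
  "continuous_on {0..1} u \<Longrightarrow> u \<in> borel_measurable unit_measure"
  for u :: "real \<Rightarrow> real"
  by (rule continuous_imp_measurable_on_sets_lebesgue) (auto intro: continuous_on_subset)

lemma continuous_on_L2:
  fixes u :: "real \<Rightarrow> real"
  assumes "continuous_on {0..1} u"
  shows "u \<in> L2"
proof -
  have "bounded (u ` {0..1})"
    by (intro compact_imp_bounded compact_continuous_image assms) auto
  then obtain C where "\<And>x. x \<in> {0..1} \<Longrightarrow> \<bar>u x\<bar> \<le> C"
    unfolding bounded_iff by (metis imageI real_norm_def)
  then show ?thesis
    by (intro L2_bounded[where C = C] continuous_on_measurable_unit assms) auto
qed

section \<open>Primitives of square-integrable functions\<close>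

text \<open>Outside \<open>[0,1]\<close> a primitive is 0, which matches the convention for elements of \<open>V\<close>.\<close>
definition primitive :: "(real \<Rightarrow> real) \<Rightarrow> real \<Rightarrow> real" where
  "primitive g x = (if x \<in> {0..1} then \<integral>t. indicator {..<x} t * g t \<partial>unit_measure else 0)"

lemma primitive_zero: "primitive g 0 = 0"
proof -
  have "(\<integral>t. indicator {..<0} t * g t \<partial>unit_measure) = (\<integral>t. 0 \<partial>unit_measure)"
    by (rule Bochner_Integration.integral_cong) (auto simp: indicator_def)
  then show ?thesis by (simp add: primitive_def)
qed

lemma primitive_add:
  assumes "g \<in> L2" "h \<in> L2"
  shows "primitive (\<lambda>x. g x + h x) x = primitive g x + primitive h x"
  using L2_integrable[OF L2_indicator_mult[of "{..<x}" g]] L2_integrable[OF L2_indicator_mult[of "{..<x}" h]]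
    assms by (simp add: primitive_def distrib_left)

lemma primitive_cmult: "primitive (\<lambda>x. c * g x) x = c * primitive g x"
  by (simp add: primitive_def mult.left_commute)

lemma primitive_diff:
  assumes "g \<in> L2" "h \<in> L2"
  shows "primitive (\<lambda>x. g x - h x) x = primitive g x - primitive h x"
  using primitive_add[OF assms(1) L2_cmult[OF assms(2), of "-1"]] primitive_cmult[of "-1" h]
  by simp

text \<open>This is Jensen's inequality on a space of measure 1: the variance of \<open>g\<close> cut off at \<open>x\<close> is
nonnegative. It later yields the Poincare inequality with constant 1.\<close>
lemma primitive_power2_le:
  assumes "g \<in> L2"
  shows "(primitive g x)\<^sup>2 \<le> (\<integral>t. (g t)\<^sup>2 \<partial>unit_measure)"
proof (cases "x \<in> {0..1}")
  case True
  define h where "h = (\<lambda>t. indicator {..<x} t * g t)"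
  define c where "c = (\<integral>t. h t \<partial>unit_measure)"
  have h: "h \<in> L2" unfolding h_def by (rule L2_indicator_mult) (use assms in auto)
  have int: "integrable unit_measure h" "integrable unit_measure (\<lambda>t. (h t)\<^sup>2)"
      "integrable unit_measure (\<lambda>t. c\<^sup>2)"
    using L2_integrable[OF h] L2_integrable[OF L2_const] h by (simp_all add: L2_def)
  have "0 \<le> (\<integral>t. (h t - c)\<^sup>2 \<partial>unit_measure)" by simp
  also have "\<dots> = (\<integral>t. (h t)\<^sup>2 - 2 * c * h t + c\<^sup>2 \<partial>unit_measure)"
    by (simp add: power2_diff algebra_simps)
  also have "\<dots> = (\<integral>t. (h t)\<^sup>2 \<partial>unit_measure) - 2 * c * c + c\<^sup>2"
    using int by (simp add: c_def[symmetric] integral_unit_measure_const del: lebesgue_integral_const)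
  finally have "c\<^sup>2 \<le> (\<integral>t. (h t)\<^sup>2 \<partial>unit_measure)" by (simp add: power2_eq_square)
  also have "\<dots> \<le> (\<integral>t. (g t)\<^sup>2 \<partial>unit_measure)"
    using int assms by (intro integral_mono) (auto simp: L2_def h_def indicator_def)
  finally show ?thesis using True by (simp add: primitive_def c_def h_def)
next
  case False
  then show ?thesis by (auto simp: primitive_def)
qed

lemma AE_unit_neq: "AE t in unit_measure. t \<noteq> x"
proof -
  have "AE t in lebesgue. t \<noteq> x"
    by (rule AE_completion) (rule AE_lborel_singleton)
  then have "AE t in lebesgue. t \<in> {0<..<1} \<longrightarrow> t \<noteq> x" by eventually_elim simp
  then show ?thesis by (simp add: AE_restrict_space_iff)
qed

lemma continuous_on_primitive:
  assumes "g \<in> L2"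
  shows "continuous_on {0..1} (primitive g)"
proof -
  have "continuous_on {0..1} (\<lambda>x. \<integral>t. indicator {..<x} t * g t \<partial>unit_measure)"
  proof (rule continuous_on_sequentiallyI)
    fix s :: "nat \<Rightarrow> real" and x assume s: "s \<longlonglongrightarrow> x"
    show "(\<lambda>n. \<integral>t. indicator {..<s n} t * g t \<partial>unit_measure)
            \<longlonglongrightarrow> (\<integral>t. indicator {..<x} t * g t \<partial>unit_measure)"
    proof (rule integral_dominated_convergence[where w = "\<lambda>t. \<bar>g t\<bar>"])
      show "integrable unit_measure (\<lambda>t. \<bar>g t\<bar>)"
        using L2_integrable[OF assms] by simp
      have "(\<lambda>n. indicator {..<s n} t * g t) \<longlonglongrightarrow> indicator {..<x} t * g t" if "t \<noteq> x" for t
      proof (rule tendsto_eventually)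
        show "\<forall>\<^sub>F n in sequentially. indicator {..<s n} t * g t = indicator {..<x} t * g t"
        proof (cases "t < x")
          case True
          then show ?thesis
            using order_tendstoD(1)[OF s True] True
            by (elim eventually_mono) (simp add: indicator_def)
        next
          case False
          then have "x < t" using that by simp
          then show ?thesis
            using order_tendstoD(2)[OF s \<open>x < t\<close>] False
            by (elim eventually_mono) (simp add: indicator_def)
        qed
      qed
      then show "AE t in unit_measure. (\<lambda>n. indicator {..<s n} t * g t) \<longlonglongrightarrow> indicator {..<x} t * g t"
        using AE_unit_neq[of x] by auto
    next
      show "(\<lambda>t. indicator {..<s n} t * g t) \<in> borel_measurable unit_measure" for n
        by (rule L2_measurable[OF L2_indicator_mult[OF _ assms]]) simp
      show "(\<lambda>t. indicator {..<x} t * g t) \<in> borel_measurable unit_measure"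
        by (rule L2_measurable[OF L2_indicator_mult[OF _ assms]]) simp
    qed (auto simp: indicator_def)
  qed
  then show ?thesis
    by (rule continuous_on_eq) (simp add: primitive_def)
qed

text \<open>Both sides integrate \<open>f x * g t\<close> over the triangle \<open>t < x\<close>. This single exchange serves as
integration by parts against test functions and also represents the load \<open>F\<close>.\<close>
lemma Fubini_triangle:
  fixes f g :: "real \<Rightarrow> real"
  assumes f: "integrable unit_measure f" and g: "integrable unit_measure g"
  shows "(\<integral>x. f x * (\<integral>t. indicator {..<x} t * g t \<partial>unit_measure) \<partial>unit_measure)
       = (\<integral>t. g t * (\<integral>x. indicator {t<..} x * f x \<partial>unit_measure) \<partial>unit_measure)"
proof -
  interpret M: finite_measure unit_measure by (rule finite_unit_measure)
  interpret pair_sigma_finite unit_measure unit_measure ..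
  let ?k = "\<lambda>(x, t). if t < x then f x * g t else 0 :: real"
  note [measurable] = borel_measurable_integrable[OF f] borel_measurable_integrable[OF g]
    ident_measurable_unit
  have fst: "(\<lambda>p. fst p) \<in> borel_measurable (unit_measure \<Otimes>\<^sub>M unit_measure)"
    and snd: "(\<lambda>p. snd p) \<in> borel_measurable (unit_measure \<Otimes>\<^sub>M unit_measure)"
    using measurable_compose[OF measurable_fst ident_measurable_unit]
      measurable_compose[OF measurable_snd ident_measurable_unit] by auto
  have k: "?k \<in> borel_measurable (unit_measure \<Otimes>\<^sub>M unit_measure)"
    unfolding case_prod_beta
    by (intro measurable_If borel_measurable_times pred_intros_logic borel_measurable_pred_less fst snd
       measurable_compose[OF measurable_fst borel_measurable_integrable[OF f]]
       measurable_compose[OF measurable_snd borel_measurable_integrable[OF g]]) auto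
  have cut: "integrable unit_measure (\<lambda>t. ?k (x, t))" for x
    by (rule Bochner_Integration.integrable_bound[where f = "\<lambda>t. f x * g t"]) (use g in auto)
  have "integrable (unit_measure \<Otimes>\<^sub>M unit_measure) ?k"
  proof (rule Fubini_integrable[OF k])
    let ?G = "\<integral>t. \<bar>g t\<bar> \<partial>unit_measure"
    show "integrable unit_measure (\<lambda>x. \<integral>t. norm (?k (x, t)) \<partial>unit_measure)"
    proof (rule Bochner_Integration.integrable_bound)
      show "integrable unit_measure (\<lambda>x. f x * ?G)" using f by simp
      show "(\<lambda>x. \<integral>t. norm (?k (x, t)) \<partial>unit_measure) \<in> borel_measurable unit_measure"
        using k by measurable
      have "(\<integral>t. norm (?k (x, t)) \<partial>unit_measure) \<le> (\<integral>t. \<bar>f x\<bar> * \<bar>g t\<bar> \<partial>unit_measure)" for x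
        using g integrable_norm[OF cut] by (intro integral_mono) (auto simp: abs_mult)
      then show "AE x in unit_measure. norm (\<integral>t. norm (?k (x, t)) \<partial>unit_measure) \<le> norm (f x * ?G)"
        by (intro AE_I2) (simp add: abs_mult)
    qed
  qed (use cut in simp)
  from Fubini_integral[of "\<lambda>x t. ?k (x, t)"] this
  have *: "(\<integral>t. (\<integral>x. ?k (x, t) \<partial>unit_measure) \<partial>unit_measure)
        = (\<integral>x. (\<integral>t. ?k (x, t) \<partial>unit_measure) \<partial>unit_measure)" by simp
  have l: "?k (x, t) = f x * (indicator {..<x} t * g t)"
    and r: "?k (x, t) = g t * (indicator {t<..} x * f x)" for x t
    by (auto simp: indicator_def)
  have "(\<integral>x. f x * (\<integral>t. indicator {..<x} t * g t \<partial>unit_measure) \<partial>unit_measure)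
      = (\<integral>x. (\<integral>t. ?k (x, t) \<partial>unit_measure) \<partial>unit_measure)"
    by (simp only: l integral_mult_right_zero)
  also have "\<dots> = (\<integral>t. (\<integral>x. ?k (x, t) \<partial>unit_measure) \<partial>unit_measure)"
    by (rule *[symmetric])
  also have "\<dots> = (\<integral>t. g t * (\<integral>x. indicator {t<..} x * f x \<partial>unit_measure) \<partial>unit_measure)"
    by (simp only: r integral_mult_right_zero)
  finally show ?thesis .
qed

section \<open>Smooth bump functions and test functions\<close>

text \<open>A recursive form of "the first \<open>k\<close> derivatives are differentiable". It peels off the innermost
derivative, so that closure under products follows by induction from the product rule alone.\<close>
primrec times_differentiable :: "nat \<Rightarrow> (real \<Rightarrow> real) \<Rightarrow> bool" where
  "times_differentiable 0 f \<longleftrightarrow> f differentiable_on UNIV"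
| "times_differentiable (Suc k) f \<longleftrightarrow> f differentiable_on UNIV \<and> times_differentiable k (deriv f)"

lemma times_differentiable_imp_differentiable:
  "times_differentiable k f \<Longrightarrow> f differentiable_on UNIV"
  by (cases k) auto

lemma times_differentiable_Suc_D: "times_differentiable (Suc k) f \<Longrightarrow> times_differentiable k f"
  by (induction k arbitrary: f) (auto dest: times_differentiable_imp_differentiable)

lemma times_differentiable_iterated_deriv:
  "times_differentiable k f \<Longrightarrow> (deriv ^^ k) f differentiable_on UNIV"
  by (induction k arbitrary: f) (auto simp: funpow_swap1)

lemma deriv_eqI: "(\<And>x. (f has_real_derivative f' x) (at x)) \<Longrightarrow> deriv f = f'"
  by (auto intro: DERIV_imp_deriv)

lemma times_differentiable_SucI:
  assumes "\<And>x. (f has_real_derivative f' x) (at x)" "times_differentiable k f'"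
  shows "times_differentiable (Suc k) f"
  using assms deriv_eqI[of f f']
  by (auto simp: differentiable_on_def intro: real_differentiable_def[THEN iffD2])

lemma times_differentiable_has_deriv:
  "times_differentiable k f \<Longrightarrow> (f has_real_derivative deriv f x) (at x)"
  by (metis DERIV_deriv_iff_real_differentiable UNIV_I differentiable_on_def
      times_differentiable_imp_differentiable)

lemma times_differentiable_add:
  "times_differentiable k f \<Longrightarrow> times_differentiable k g \<Longrightarrow> times_differentiable k (\<lambda>x. f x + g x)"
proof (induction k arbitrary: f g)
  case 0
  then show ?case by (simp add: differentiable_on_add)
next
  case (Suc k)
  note [derivative_intros] = times_differentiable_has_deriv[OF Suc.prems(1)]
    times_differentiable_has_deriv[OF Suc.prems(2)]
  show ?case
    by (rule times_differentiable_SucI[where f' = "\<lambda>x. deriv f x + deriv g x"])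
       (use Suc in \<open>auto intro!: derivative_eq_intros\<close>)
qed

lemma times_differentiable_mult:
  "times_differentiable k f \<Longrightarrow> times_differentiable k g \<Longrightarrow> times_differentiable k (\<lambda>x. f x * g x)"
proof (induction k arbitrary: f g)
  case 0
  then show ?case by (simp add: differentiable_on_mult)
next
  case (Suc k)
  show ?case
  proof (rule times_differentiable_SucI[where f' = "\<lambda>x. deriv f x * g x + f x * deriv g x"])
    show "((\<lambda>x. f x * g x) has_real_derivative deriv f x * g x + f x * deriv g x) (at x)" for x
      using DERIV_mult[OF times_differentiable_has_deriv[OF Suc.prems(1)]
          times_differentiable_has_deriv[OF Suc.prems(2)]] by (simp add: mult.commute add.commute)
    show "times_differentiable k (\<lambda>x. deriv f x * g x + f x * deriv g x)"
      using Suc.prems times_differentiable_Suc_D[OF Suc.prems(1)] times_differentiable_Suc_D[OF Suc.prems(2)]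
      by (intro times_differentiable_add Suc.IH) auto
  qed
qed

lemma times_differentiable_const: "times_differentiable k (\<lambda>x. c)"
proof (induction k arbitrary: c)
  case (Suc k)
  show ?case
    by (rule times_differentiable_SucI[where f' = "\<lambda>x. 0"]) (use Suc in auto)
qed auto

text \<open>The classical smooth function that vanishes to infinite order at 0, with a polynomial factor in
\<open>1/x\<close>: with this factor the family is closed under differentiation.\<close>
definition flat :: "real poly \<Rightarrow> real \<Rightarrow> real" where
  "flat p x = (if x > 0 then poly p (1 / x) * exp (- 1 / x) else 0)"

lemma poly_exp_tendsto_0: "((\<lambda>x::real. poly p x * exp (- x)) \<longlongrightarrow> 0) at_top"
proof -
  have "((\<lambda>x::real. \<Sum>i\<le>degree p. coeff p i * (x ^ i / exp x)) \<longlongrightarrow> (\<Sum>i\<le>degree p. coeff p i * 0)) at_top"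
    by (intro tendsto_intros tendsto_power_div_exp_0)
  then show ?thesis
    by (simp add: poly_altdef sum_distrib_right exp_minus divide_inverse mult.assoc)
qed

lemma flat_has_derivative:
  "(flat p has_real_derivative flat ([:0, 0, 1:] * (p - pderiv p)) x) (at x)"
proof -
  consider "x > 0" | "x < 0" | "x = 0" by linarith
  then show ?thesis
  proof cases
    case 1
    have "((\<lambda>x. poly p (1 / x) * exp (- 1 / x)) has_real_derivative
        flat ([:0, 0, 1:] * (p - pderiv p)) x) (at x)"
      using 1 by (auto intro!: derivative_eq_intros DERIV_chain2[OF poly_DERIV]
          simp: flat_def field_simps power2_eq_square)
    then show ?thesis
      by (rule has_field_derivative_transform_within_open[where S = "{0<..}"])
        (use 1 in \<open>simp_all add: flat_def\<close>)
  next
    case 2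
    have "((\<lambda>x. 0) has_real_derivative flat ([:0, 0, 1:] * (p - pderiv p)) x) (at x)"
      using 2 by (auto simp: flat_def)
    then show ?thesis
      by (rule has_field_derivative_transform_within_open[where S = "{..<0}"])
        (use 2 in \<open>simp_all add: flat_def\<close>)
  next
    case 3
    \<comment> \<open>The exponential beats every polynomial in \<open>1/h\<close>, also the one with the extra factor \<open>1/h\<close>.\<close>
    have "((\<lambda>h. flat p h / h) \<longlongrightarrow> 0) (at 0)"
    proof (rule filterlim_split_at)
      show "((\<lambda>h. flat p h / h) \<longlongrightarrow> 0) (at_left 0)"
        by (rule tendsto_eventually) (auto simp: eventually_at_filter flat_def)
      have "((\<lambda>h. poly (pCons 0 p) (inverse h) * exp (- inverse h)) \<longlongrightarrow> 0) (at_right 0)"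
        by (rule filterlim_compose[OF poly_exp_tendsto_0 filterlim_inverse_at_top_right])
      then show "((\<lambda>h. flat p h / h) \<longlongrightarrow> 0) (at_right 0)"
        by (rule Lim_transform_eventually)
          (auto simp: eventually_at_filter flat_def divide_inverse mult_ac)
    qed
    then show ?thesis
      using 3 by (simp add: DERIV_def flat_def)
  qed
qed

text \<open>Affine arguments are included because a bump uses \<open>x - a\<close> and \<open>b - x\<close>; the inner derivative is
only a constant factor.\<close>
lemma times_differentiable_flat_affine: "times_differentiable k (\<lambda>x. flat p (c * x + d))"
proof (induction k arbitrary: p)
  case 0
  have "((\<lambda>x. flat p (c * x + d)) has_real_derivative
      flat ([:0, 0, 1:] * (p - pderiv p)) (c * x + d) * c) (at x)" for x
    by (rule DERIV_chain2[OF flat_has_derivative]) (auto intro!: derivative_eq_intros)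
  then show ?case
    by (auto simp: differentiable_on_def real_differentiable_def)
next
  case (Suc k)
  show ?case
  proof (rule times_differentiable_SucI)
    show "((\<lambda>x. flat p (c * x + d)) has_real_derivative
      flat ([:0, 0, 1:] * (p - pderiv p)) (c * x + d) * c) (at x)" for x
      by (rule DERIV_chain2[OF flat_has_derivative]) (auto intro!: derivative_eq_intros)
    show "times_differentiable k (\<lambda>x. flat ([:0, 0, 1:] * (p - pderiv p)) (c * x + d) * c)"
      by (intro times_differentiable_mult times_differentiable_const Suc.IH)
  qed
qed

definition bump :: "real \<Rightarrow> real \<Rightarrow> real \<Rightarrow> real" where
  "bump a b x = flat 1 (x - a) * flat 1 (b - x)"

lemma times_differentiable_bump: "times_differentiable k (bump a b)"
  using times_differentiable_mult[OF times_differentiable_flat_affine[of k 1 1 "-a"]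
      times_differentiable_flat_affine[of k 1 "-1" b]]
  by (simp add: bump_def[abs_def])

lemma bump_nonneg: "bump a b x \<ge> 0"
  by (simp add: bump_def flat_def)

lemma bump_pos: "a < x \<Longrightarrow> x < b \<Longrightarrow> bump a b x > 0"
  by (simp add: bump_def flat_def)

lemma bump_eq_0: "x \<le> a \<or> b \<le> x \<Longrightarrow> bump a b x = 0"
  by (auto simp: bump_def flat_def)

lemma times_differentiable_continuous_on: "times_differentiable k f \<Longrightarrow> continuous_on S f"
  using differentiable_imp_continuous_on[OF times_differentiable_imp_differentiable]
    continuous_on_subset by blast

lemma test_functionsI:
  assumes "\<And>k. times_differentiable k \<phi>" "0 < a" "b < 1" "\<And>x. x \<notin> {a..b} \<Longrightarrow> \<phi> x = 0"
  shows "\<phi> \<in> test_functions"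
proof -
  have sub: "closure {x. \<phi> x \<noteq> 0} \<subseteq> {a..b}"
  proof (rule closure_minimal)
    show "{x. \<phi> x \<noteq> 0} \<subseteq> {a..b}" using assms(4) by blast
  qed simp
  have "compact (closure {x. \<phi> x \<noteq> 0})"
    using compact_Int_closed[OF compact_Icc closed_closure] sub by (metis inf.absorb2)
  moreover have "closure {x. \<phi> x \<noteq> 0} \<subseteq> {0<..<1}"
    by (rule subset_trans[OF sub]) (use assms(2,3) in auto)
  ultimately show ?thesis
    using times_differentiable_iterated_deriv[OF assms(1)] by (simp add: test_functions_def)
qed

text \<open>The indicator restricts the integral to a subinterval, in the form in which the triangle
formula produces it.\<close>
lemma integral_unit_FTC:
  fixes \<Phi> \<phi> :: "real \<Rightarrow> real"
  assumes deriv: "\<And>x. x \<in> {a..b} \<Longrightarrow> (\<Phi> has_real_derivative \<phi> x) (at x)"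
    and cont: "continuous_on {0..1} \<phi>" and ab: "0 \<le> a" "a \<le> b" "b \<le> 1"
  shows "(\<integral>x. indicator {a<..<b} x * \<phi> x \<partial>unit_measure) = \<Phi> b - \<Phi> a"
proof -
  let ?f = "\<lambda>x. indicator {a<..<b} x * \<phi> x"
  have "(\<phi> has_integral \<Phi> b - \<Phi> a) {a..b}"
    using ab by (intro fundamental_theorem_of_calculus)
      (auto intro!: has_field_derivative_at_within[OF deriv]
        simp: has_real_derivative_iff_has_vector_derivative[symmetric])
  then have "(\<phi> has_integral \<Phi> b - \<Phi> a) {a<..<b}"
    by (simp add: has_integral_Icc_iff_Ioo)
  then have "((\<lambda>x. if x \<in> {a<..<b} then \<phi> x else 0) has_integral \<Phi> b - \<Phi> a) {0<..<1}"
    using ab by (subst has_integral_restrict) auto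
  also have "(\<lambda>x. if x \<in> {a<..<b} then \<phi> x else 0) = ?f"
    by (auto simp: indicator_def)
  finally have "integral {0<..<1} ?f = \<Phi> b - \<Phi> a" by (rule integral_unique)
  moreover have "integrable unit_measure ?f"
    by (intro L2_integrable L2_indicator_mult continuous_on_L2 cont) auto
  ultimately show ?thesis
    by (simp add: lebesgue_integral_eq_integral)
qed

lemma integral_unit_FTC_whole:
  fixes \<Phi> \<phi> :: "real \<Rightarrow> real"
  assumes "\<And>x. x \<in> {0..1} \<Longrightarrow> (\<Phi> has_real_derivative \<phi> x) (at x)" "continuous_on {0..1} \<phi>"
  shows "(\<integral>x. \<phi> x \<partial>unit_measure) = \<Phi> 1 - \<Phi> 0"
proof -
  have "(\<integral>x. \<phi> x \<partial>unit_measure) = (\<integral>x. indicator {0<..<1} x * \<phi> x \<partial>unit_measure)"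
    by (rule Bochner_Integration.integral_cong) auto
  then show ?thesis using integral_unit_FTC[of 0 1 \<Phi> \<phi>] assms by simp
qed

lemma integral_unit_pos:
  fixes f :: "real \<Rightarrow> real"
  assumes int: "integrable unit_measure f" and nonneg: "\<And>x. x \<in> {0<..<1} \<Longrightarrow> 0 \<le> f x"
    and pos: "\<And>x. x \<in> {a<..<b} \<Longrightarrow> 0 < f x" and ab: "0 \<le> a" "a < b" "b \<le> 1"
  shows "0 < (\<integral>x. f x \<partial>unit_measure)"
proof (rule ccontr)
  have nonneg_AE: "AE x in unit_measure. 0 \<le> f x"
    using nonneg by (intro AE_I2) auto
  assume "\<not> 0 < (\<integral>x. f x \<partial>unit_measure)"
  moreover have "0 \<le> (\<integral>x. f x \<partial>unit_measure)"
    using nonneg_AE by (rule integral_nonneg_AE)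
  ultimately have "(\<integral>x. f x \<partial>unit_measure) = 0" by simp
  then have "AE x in unit_measure. f x = 0"
    using integral_nonneg_eq_0_iff_AE[OF int nonneg_AE] by simp
  then have "AE x in unit_measure. x \<notin> {a<..<b}"
    by eventually_elim (use pos in force)
  then have "AE x in lebesgue. x \<notin> {a<..<b}"
    using ab by (simp add: AE_restrict_space_iff) (auto elim!: eventually_mono)
  then have "{a<..<b} \<in> null_sets lebesgue"
    by (subst (asm) AE_iff_null_sets[symmetric]) auto
  then have "emeasure lebesgue {a<..<b} = 0" by (rule null_setsD1)
  then show False using ab by simp
qed

lemma test_functionsE:
  assumes "\<phi> \<in> test_functions"
  shows test_function_has_deriv: "(\<phi> has_real_derivative deriv \<phi> x) (at x)"
    and test_function_deriv_continuous: "continuous_on S (deriv \<phi>)"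
    and test_function_0: "\<phi> 0 = 0" and test_function_1: "\<phi> 1 = 0"
proof -
  have d: "(deriv ^^ k) \<phi> differentiable_on UNIV" for k
    using assms by (simp add: test_functions_def)
  show "(\<phi> has_real_derivative deriv \<phi> x) (at x)"
    using d[of 0] by (simp add: differentiable_on_def DERIV_deriv_iff_real_differentiable)
  have "continuous_on UNIV (deriv \<phi>)"
    using differentiable_imp_continuous_on[OF d[of 1]] by simp
  then show "continuous_on S (deriv \<phi>)" by (rule continuous_on_subset) simp
  have "closure {x. \<phi> x \<noteq> 0} \<subseteq> {0<..<1}" using assms by (simp add: test_functions_def)
  then have "{x. \<phi> x \<noteq> 0} \<subseteq> {0<..<1}" by (rule subset_trans[OF closure_subset])
  then have "\<phi> x = 0" if "x \<notin> {0<..<1}" for x using that by blast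
  from this[of 0] this[of 1] show "\<phi> 0 = 0" "\<phi> 1 = 0" by simp_all
qed

section \<open>Weak derivatives of primitives and the lemma of du Bois-Reymond\<close>

text \<open>Exchanging the integrals leaves \<open>\<integral>\<^sub>t\<^sup>1 \<phi>'\<close>, which is \<open>-\<phi> t\<close> because \<open>\<phi> 1 = 0\<close>.\<close>
lemma has_L2_weak_deriv_primitive:
  assumes g: "g \<in> L2"
  shows "has_L2_weak_deriv (primitive g) g"
  unfolding has_L2_weak_deriv_def
proof (intro conjI ballI g)
  show "primitive g \<in> L2" by (intro continuous_on_L2 continuous_on_primitive g)
  fix \<phi> assume \<phi>: "\<phi> \<in> test_functions"
  note cont = test_function_deriv_continuous[OF \<phi>]
  have "(\<integral>x. primitive g x * deriv \<phi> x \<partial>unit_measure)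
      = (\<integral>x. deriv \<phi> x * (\<integral>t. indicator {..<x} t * g t \<partial>unit_measure) \<partial>unit_measure)"
    by (rule Bochner_Integration.integral_cong) (auto simp: primitive_def)
  also have "\<dots> = (\<integral>t. g t * (\<integral>x. indicator {t<..} x * deriv \<phi> x \<partial>unit_measure) \<partial>unit_measure)"
    by (intro Fubini_triangle L2_integrable continuous_on_L2 cont g)
  also have "\<dots> = (\<integral>t. - (g t * \<phi> t) \<partial>unit_measure)"
  proof (rule Bochner_Integration.integral_cong[OF refl])
    fix t :: real assume "t \<in> space unit_measure"
    then have t: "0 < t" "t < 1" by auto
    have "(\<integral>x. indicator {t<..} x * deriv \<phi> x \<partial>unit_measure)
        = (\<integral>x. indicator {t<..<1} x * deriv \<phi> x \<partial>unit_measure)"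
      by (rule Bochner_Integration.integral_cong) (auto simp: indicator_def)
    also have "\<dots> = \<phi> 1 - \<phi> t"
      by (rule integral_unit_FTC) (use test_function_has_deriv[OF \<phi>] cont t in auto)
    finally show "g t * (\<integral>x. indicator {t<..} x * deriv \<phi> x \<partial>unit_measure) = - (g t * \<phi> t)"
      using test_function_1[OF \<phi>] by simp
  qed
  finally show "(\<integral>x. primitive g x * deriv \<phi> x \<partial>unit_measure) = - (\<integral>x. g x * \<phi> x \<partial>unit_measure)"
    by simp
qed

text \<open>An antiderivative is constant on each side of the support of \<open>\<psi>\<close>; the two constants differ
by the integral of \<open>\<psi>\<close>, so mean value zero is what makes it compactly supported.\<close>
lemma test_function_antiderivative:
  assumes smooth: "\<And>k. times_differentiable k \<psi>"
    and supp: "\<And>x. x \<notin> {l..r} \<Longrightarrow> \<psi> x = 0" and lr: "0 < l" "l \<le> r" "r < 1"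
    and int0: "(\<integral>x. \<psi> x \<partial>unit_measure) = 0"
  obtains \<phi> where "\<phi> \<in> test_functions" "deriv \<phi> = \<psi>"
proof -
  have cont: "continuous_on S \<psi>" for S
    by (rule times_differentiable_continuous_on[OF smooth])
  have "\<exists>F. \<forall>x. - \<infinity> < ereal x \<longrightarrow> ereal x < \<infinity> \<longrightarrow> (F has_vector_derivative \<psi> x) (at x)"
    by (rule einterval_antiderivative)
      (use cont[of UNIV] in \<open>simp_all add: continuous_on_eq_continuous_at\<close>)
  then obtain F where "(F has_real_derivative \<psi> x) (at x)" for x
    by (auto simp: has_real_derivative_iff_has_vector_derivative)
  then have F: "((\<lambda>x. F x - F 0) has_real_derivative \<psi> x) (at x)" for x
    by (auto intro!: derivative_eq_intros)
  define \<phi> where "\<phi> = (\<lambda>x. F x - F 0)"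
  have \<phi>: "(\<phi> has_real_derivative \<psi> x) (at x)" for x
    using F by (simp add: \<phi>_def)
  have d: "deriv \<phi> = \<psi>" by (rule deriv_eqI) (rule \<phi>)
  have const: "\<phi> x = \<phi> y" if "convex S" "x \<in> S" "y \<in> S" "\<And>z. z \<in> S \<Longrightarrow> \<psi> z = 0" for S x y
  proof -
    have "\<exists>c. \<forall>z\<in>S. \<phi> z = c"
    proof (rule has_field_derivative_zero_constant[OF that(1)])
      show "(\<phi> has_field_derivative 0) (at z within S)" if "z \<in> S" for z
        using has_field_derivative_at_within[OF \<phi>[of z], of S] \<open>\<And>z. z \<in> S \<Longrightarrow> \<psi> z = 0\<close>[OF that]
        by simp
    qed
    then show ?thesis using that by auto
  qed
  have "\<phi> 0 = 0" by (simp add: \<phi>_def)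
  moreover have "\<phi> 1 = 0"
    using integral_unit_FTC_whole[of \<phi> \<psi>] \<phi> cont int0 \<open>\<phi> 0 = 0\<close> by simp
  ultimately have zero: "\<phi> x = 0" if "x \<notin> {l..r}" for x
    using const[of "{..<l}" x 0] const[of "{r<..}" x 1] supp lr that
    by (cases "x < l") auto
  have "\<phi> \<in> test_functions"
  proof (rule test_functionsI[where a = l and b = r])
    show "times_differentiable k \<phi>" for k
      by (rule times_differentiable_Suc_D) (rule times_differentiable_SucI[OF \<phi> smooth])
  qed (use lr zero in auto)
  then show thesis using d that by blast
qed

text \<open>If \<open>w s < c < w t\<close>, take a bump near \<open>s\<close>, where \<open>w < c\<close>, and a bump near \<open>t\<close>, where \<open>w > c\<close>. Their
difference, weighted to have mean value zero, is the derivative of a test function. Because of the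
mean value zero, \<open>w\<close> may be replaced by \<open>w - c\<close> under the integral, and then both bumps contribute
strictly positively to an integral that is 0.\<close>
lemma du_Bois_Reymond_less:
  fixes w :: "real \<Rightarrow> real"
  assumes cont: "continuous_on {0..1} w"
    and weak: "\<And>\<phi>. \<phi> \<in> test_functions \<Longrightarrow> (\<integral>x. w x * deriv \<phi> x \<partial>unit_measure) = 0"
    and s: "s \<in> {0<..<1}" and t: "t \<in> {0<..<1}"
  shows "\<not> w s < w t"
proof
  assume "w s < w t"
  then obtain c where c: "w s < c" "c < w t" using dense[of "w s" "w t"] by auto
  have near: "\<exists>a b. 0 < a \<and> a < b \<and> b < 1 \<and> (\<forall>x\<in>{a<..<b}. P (w x))"
    if P: "open {y. P y}" "P (w x)" "x \<in> {0<..<1}" for P x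
  proof -
    have "continuous_on {0<..<1} w" by (rule continuous_on_subset[OF cont]) auto
    then have "open ({0<..<1} \<inter> w -` {y. P y})"
      by (rule continuous_open_preimage) (use P in simp_all)
    then obtain e where e: "e > 0" "ball x e \<subseteq> {0<..<1} \<inter> w -` {y. P y}"
      by (rule openE[where x = x]) (use P in auto)
    define d where "d = min (e / 2) (min (x / 2) ((1 - x) / 2))"
    have d: "0 < d" "d < e" "d < x" "d < 1 - x"
      using e P(3) by (auto simp: d_def min_def)
    then have "{x - d<..<x + d} \<subseteq> ball x e"
      by (auto simp: dist_real_def)
    then show ?thesis
      using e d P(3) by (intro exI[of _ "x - d"] exI[of _ "x + d"]) auto
  qed
  obtain a b where ab: "0 < a" "a < b" "b < 1" and wab: "\<And>x. x \<in> {a<..<b} \<Longrightarrow> w x < c"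
    using near[of "\<lambda>y. y < c" s, OF open_Collect_less[OF continuous_on_id continuous_on_const] c(1) s]
    by blast
  obtain a' b' where ab': "0 < a'" "a' < b'" "b' < 1" and wab': "\<And>x. x \<in> {a'<..<b'} \<Longrightarrow> c < w x"
    using near[of "\<lambda>y. c < y" t, OF open_Collect_less[OF continuous_on_const continuous_on_id] c(2) t]
    by blast
  define I where "I = (\<integral>x. bump a b x \<partial>unit_measure)"
  define I' where "I' = (\<integral>x. bump a' b' x \<partial>unit_measure)"
  have bL2: "bump a b \<in> L2" for a b
    by (rule continuous_on_L2) (rule times_differentiable_continuous_on[OF times_differentiable_bump])
  have wL2: "(\<lambda>x. w x - c) \<in> L2" "(\<lambda>x. c - w x) \<in> L2"
    by (intro L2_diff L2_const continuous_on_L2[OF cont])+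
  have I: "I > 0" "I' > 0"
    unfolding I_def I'_def
    using integral_unit_pos[OF L2_integrable[OF bL2] bump_nonneg, of a b a b] bump_pos ab
      integral_unit_pos[OF L2_integrable[OF bL2] bump_nonneg, of a' b' a' b'] ab' by auto
  have J: "0 < (\<integral>x. (c - w x) * bump a b x \<partial>unit_measure)"
  proof (rule integral_unit_pos)
    show "0 \<le> (c - w x) * bump a b x" for x
      using wab[of x] bump_nonneg[of a b x] bump_eq_0[of x a b]
      by (cases "x \<in> {a<..<b}") auto
    show "0 < (c - w x) * bump a b x" if "x \<in> {a<..<b}" for x
      using wab[OF that] bump_pos[of a x b] that by auto
  qed (use ab L2_integrable_mult[OF wL2(2) bL2] in auto)
  have J': "0 < (\<integral>x. (w x - c) * bump a' b' x \<partial>unit_measure)"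
  proof (rule integral_unit_pos)
    show "0 \<le> (w x - c) * bump a' b' x" for x
      using wab'[of x] bump_nonneg[of a' b' x] bump_eq_0[of x a' b']
      by (cases "x \<in> {a'<..<b'}") auto
    show "0 < (w x - c) * bump a' b' x" if "x \<in> {a'<..<b'}" for x
      using wab'[OF that] bump_pos[of a' x b'] that by auto
  qed (use ab' L2_integrable_mult[OF wL2(1) bL2] in auto)
  \<comment> \<open>Each bump is weighted by the mass of the other one, so that the total mass is 0.\<close>
  define \<psi> where "\<psi> = (\<lambda>x. I * bump a' b' x + (- I') * bump a b x)"
  have int\<psi>: "(\<integral>x. \<psi> x \<partial>unit_measure) = 0"
    using L2_integrable[OF bL2] by (simp add: \<psi>_def I_def I'_def)
  obtain \<phi> where "\<phi> \<in> test_functions" "deriv \<phi> = \<psi>"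
  proof (rule test_function_antiderivative[of \<psi> "min a a'" "max b b'"])
    show "times_differentiable k \<psi>" for k
      unfolding \<psi>_def
      by (intro times_differentiable_add times_differentiable_mult times_differentiable_const
          times_differentiable_bump)
    show "\<psi> x = 0" if x: "x \<notin> {min a a'..max b b'}" for x
    proof -
      have "x \<le> a \<or> b \<le> x" "x \<le> a' \<or> b' \<le> x" using x by auto
      then show ?thesis by (simp add: \<psi>_def bump_eq_0)
    qed
  qed (use ab ab' int\<psi> in auto)
  then have "(\<integral>x. w x * \<psi> x \<partial>unit_measure) = 0" using weak by metis
  moreover have \<psi>L2: "\<psi> \<in> L2" unfolding \<psi>_def by (intro L2_add L2_cmult bL2)
  ultimately have "(\<integral>x. w x * \<psi> x - c * \<psi> x \<partial>unit_measure) = 0"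
    using int\<psi> L2_integrable_mult[OF continuous_on_L2[OF cont] \<psi>L2] L2_integrable[OF \<psi>L2] by simp
  also have "(\<lambda>x. w x * \<psi> x - c * \<psi> x)
      = (\<lambda>x. I * ((w x - c) * bump a' b' x) + I' * ((c - w x) * bump a b x))"
    by (auto simp: \<psi>_def algebra_simps)
  also have "(\<integral>x. I * ((w x - c) * bump a' b' x) + I' * ((c - w x) * bump a b x) \<partial>unit_measure)
      = I * (\<integral>x. (w x - c) * bump a' b' x \<partial>unit_measure) + I' * (\<integral>x. (c - w x) * bump a b x \<partial>unit_measure)"
    using L2_integrable_mult[OF wL2(1) bL2] L2_integrable_mult[OF wL2(2) bL2] by simp
  finally show False
    using mult_pos_pos[OF I(1) J'] mult_pos_pos[OF I(2) J] by linarith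
qed

lemma du_Bois_Reymond:
  fixes w :: "real \<Rightarrow> real"
  assumes cont: "continuous_on {0..1} w"
    and weak: "\<And>\<phi>. \<phi> \<in> test_functions \<Longrightarrow> (\<integral>x. w x * deriv \<phi> x \<partial>unit_measure) = 0"
    and x: "x \<in> {0..1}"
  shows "w x = w 0"
proof -
  have const: "w y = w (1/2)" if "y \<in> {0<..<1}" for y
  proof (rule antisym)
    show "w y \<le> w (1/2)"
      unfolding not_less[symmetric] by (rule du_Bois_Reymond_less[OF cont weak _ that]) simp_all
    show "w (1/2) \<le> w y"
      unfolding not_less[symmetric] by (rule du_Bois_Reymond_less[OF cont weak that]) simp_all
  qed
  have "w y = w (1/2)" if "y \<in> {0..1}" for y
    by (rule continuous_constant_on_closure[of "{0<..<1}" w]) (use cont that in simp, rule const, use that in simp_all)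
  from this[OF x] this[of 0] show ?thesis by simp
qed

lemma eq_primitive_of_weak_deriv:
  assumes u: "has_L2_weak_deriv u g" and cont: "continuous_on {0..1} u" and "u 0 = 0"
    and x: "x \<in> {0..1}"
  shows "u x = primitive g x"
proof -
  have g: "g \<in> L2" and uL2: "u \<in> L2" using u by (auto simp: has_L2_weak_deriv_def)
  have "u x - primitive g x = u 0 - primitive g 0"
  proof (rule du_Bois_Reymond[OF _ _ x])
    show "continuous_on {0..1} (\<lambda>x. u x - primitive g x)"
      by (intro continuous_on_diff cont continuous_on_primitive g)
    fix \<phi> assume \<phi>: "\<phi> \<in> test_functions"
    have d: "deriv \<phi> \<in> L2" by (rule continuous_on_L2[OF test_function_deriv_continuous[OF \<phi>]])
    have "(\<integral>x. u x * deriv \<phi> x \<partial>unit_measure) = (\<integral>x. primitive g x * deriv \<phi> x \<partial>unit_measure)"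
      using u has_L2_weak_deriv_primitive[OF g] \<phi> by (simp add: has_L2_weak_deriv_def)
    then show "(\<integral>x. (u x - primitive g x) * deriv \<phi> x \<partial>unit_measure) = 0"
      using L2_integrable_mult[OF uL2 d]
        L2_integrable_mult[OF continuous_on_L2[OF continuous_on_primitive[OF g]] d]
      by (simp add: left_diff_distrib)
  qed
  then show ?thesis using \<open>u 0 = 0\<close> primitive_zero by simp
qed

text \<open>The half-lines form an intersection-stable generator of the Borel sets, so Dynkin's theorem
makes the integral of \<open>g\<close> vanish on every Borel set. A Lebesgue set differs from a Borel set by a null
set, and a density with vanishing integral over all measurable sets is 0 almost everywhere.\<close>
lemma AE_eq_0_if_primitive_eq_0:
  assumes g: "g \<in> L2" and zero: "\<And>x. x \<in> {0..1} \<Longrightarrow> primitive g x = 0"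
  shows "AE x in unit_measure. g x = 0"
proof -
  interpret finite_measure unit_measure by (rule finite_unit_measure)
  note int = L2_integrable[OF L2_indicator_mult[OF _ g]]
  have below: "(\<integral>t. indicator {..<x} t * g t \<partial>unit_measure) = 0" for x
  proof -
    define y where "y = max 0 (min 1 x)"
    have "(\<integral>t. indicator {..<x} t * g t \<partial>unit_measure) = (\<integral>t. indicator {..<y} t * g t \<partial>unit_measure)"
      by (rule Bochner_Integration.integral_cong) (auto simp: y_def indicator_def)
    also have "\<dots> = primitive g y" by (simp add: primitive_def y_def)
    finally show ?thesis using zero[of y] by (simp add: y_def)
  qed
  have total: "(\<integral>t. g t \<partial>unit_measure) = 0"
  proof -
    have "(\<integral>t. g t \<partial>unit_measure) = (\<integral>t. indicator {..<1} t * g t \<partial>unit_measure)"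
      by (rule Bochner_Integration.integral_cong) auto
    then show ?thesis using below by simp
  qed
  have borel: "(\<integral>t. indicator S t * g t \<partial>unit_measure) = 0" if "S \<in> sets borel" for S
  proof -
    have gen: "sets (borel :: real measure) = sigma_sets UNIV (range lessThan)"
      by (simp add: borel_Iio)
    have S: "S \<in> sigma_sets UNIV (range lessThan)" using that gen by simp
    have stable: "Int_stable (range lessThan :: real set set)"
    proof -
      have "{..<x} \<inter> {..<y} = {..<min x y}" for x y :: real by auto
      then show ?thesis by (auto simp: Int_stable_def)
    qed
    have subset: "range lessThan \<subseteq> (Pow UNIV :: real set set)" by simp
    from stable subset S show ?thesis
    proof (induction rule: sigma_sets_induct_disjoint)
      case (basic A)
      then show ?case using below by auto
    next
      case (compl A)
      have "(\<integral>t. indicator (UNIV - A) t * g t \<partial>unit_measure)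
          = (\<integral>t. g t - indicator A t * g t \<partial>unit_measure)"
        by (rule Bochner_Integration.integral_cong) (auto simp: indicator_def)
      also have "\<dots> = 0"
        using compl int[of A] L2_integrable[OF g] total gen by simp
      finally show ?case .
    next
      case (union A)
      define C where "C = (\<lambda>i. A i \<inter> {0<..<1})"
      have C_borel: "C i \<in> sets borel" for i
      proof -
        have "A i \<in> sets borel" using union(2) gen by blast
        then show ?thesis by (simp add: C_def)
      qed
      have C_meas: "C i \<in> sets unit_measure" for i
        using C_borel[of i] by (simp add: sets_restrict_space_iff C_def)
      have C_eq: "indicator (\<Union>(range A)) t * g t = indicator (\<Union>i. C i) t * g t"
        "indicator (A i) t * g t = indicator (C i) t * g t" if "t \<in> {0<..<1}" for t i
        using that by (auto simp: C_def indicator_def)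
      have piece: "(LINT t:C i|unit_measure. g t) = 0" for i
      proof -
        have "(LINT t:C i|unit_measure. g t) = (\<integral>t. indicator (A i) t * g t \<partial>unit_measure)"
          unfolding set_lebesgue_integral_def real_scaleR_def
          by (rule Bochner_Integration.integral_cong[OF refl]) (simp add: C_eq)
        then show ?thesis using union(3) by simp
      qed
      have "(\<integral>t. indicator (\<Union>(range A)) t * g t \<partial>unit_measure)
          = (LINT t:(\<Union>i. C i)|unit_measure. g t)"
        unfolding set_lebesgue_integral_def real_scaleR_def
        by (rule Bochner_Integration.integral_cong[OF refl]) (simp add: C_eq)
      also have "\<dots> = (\<Sum>i. (LINT t:C i|unit_measure. g t))"
      proof (rule lebesgue_integral_countable_add[OF C_meas])
        show "C i \<inter> C j = {}" if "i \<noteq> j" for i j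
          using disjoint_family_onD[OF union(1) _ _ that] by (auto simp: C_def)
        show "set_integrable unit_measure (\<Union>i. C i) g"
          using int[of "\<Union>i. C i"] C_borel by (auto simp: set_integrable_def)
      qed
      finally show ?case by (simp add: piece)
    qed simp_all
  qed
  show ?thesis
  proof (rule density_zero[OF L2_integrable[OF g]])
    fix A assume "A \<in> sets unit_measure"
    then have "A \<in> sets lebesgue" by (auto simp: sets_restrict_space_iff)
    then obtain S N N' where A: "A = S \<union> N" "N \<subseteq> N'" "N' \<in> null_sets lborel" "S \<in> sets lborel"
      by (rule sets_completionE)
    have "AE t in lebesgue. t \<notin> N'"
      using null_sets_completionI[OF A(3)] by (rule AE_not_in)
    then have "AE t in lebesgue. t \<in> {0<..<1} \<longrightarrow> t \<notin> N'" by eventually_elim simp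
    then have N': "AE t in unit_measure. t \<notin> N'" by (simp add: AE_restrict_space_iff)
    have "(\<integral>t. indicator A t * g t \<partial>unit_measure) = (\<integral>t. indicator S t * g t \<partial>unit_measure)"
    proof (rule integral_cong_AE)
      show "(\<lambda>t. indicator A t * g t) \<in> borel_measurable unit_measure"
        using \<open>A \<in> sets unit_measure\<close> L2_measurable[OF g] by simp
      show "(\<lambda>t. indicator S t * g t) \<in> borel_measurable unit_measure"
        using A(4) by (intro L2_measurable L2_indicator_mult g) simp
      show "AE t in unit_measure. indicator A t * g t = indicator S t * g t"
        using N' by eventually_elim (use A in \<open>auto simp: indicator_def\<close>)
    qed
    then show "set_lebesgue_integral unit_measure A g = 0"
      using borel[of S] A(4) by (simp add: set_lebesgue_integral_def)
  qed
qed

section \<open>The space \<open>V\<close> as the space of primitives\<close>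

lemma V_eq_primitives: "V = primitive ` L2"
proof (intro equalityI subsetI)
  fix u assume u: "u \<in> V"
  then obtain g where g: "has_L2_weak_deriv u g" by (auto simp: V_def H1_def)
  have "u x = primitive g x" for x
    using eq_primitive_of_weak_deriv[OF g, of x] u
    by (cases "x \<in> {0..1}") (auto simp: V_def primitive_def)
  then have "u = primitive g" by (rule ext)
  then show "u \<in> primitive ` L2" using g by (auto simp: has_L2_weak_deriv_def)
next
  fix u assume "u \<in> primitive ` L2"
  then obtain g where "g \<in> L2" "u = primitive g" by blast
  then show "u \<in> V"
    using has_L2_weak_deriv_primitive[of g] continuous_on_primitive[of g] primitive_zero[of g]
    by (auto simp: V_def H1_def primitive_def)
qed

lemma V_cases:
  assumes "u \<in> V"
  obtains g where "g \<in> L2" "u = primitive g"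
  using assms V_eq_primitives by blast

text \<open>The chosen representative is some weak derivative; all of them have the same primitive, hence
agree almost everywhere.\<close>
lemma weak_deriv_primitive:
  assumes g: "g \<in> L2"
  shows "weak_deriv (primitive g) \<in> L2" "AE x in unit_measure. weak_deriv (primitive g) x = g x"
proof -
  let ?w = "weak_deriv (primitive g)"
  have w: "has_L2_weak_deriv (primitive g) ?w"
    unfolding weak_deriv_def
    by (rule someI[of "has_L2_weak_deriv (primitive g)" g]) (rule has_L2_weak_deriv_primitive[OF g])
  then show wL2: "?w \<in> L2" by (simp add: has_L2_weak_deriv_def)
  have "AE x in unit_measure. ?w x - g x = 0"
    by (rule AE_eq_0_if_primitive_eq_0[OF L2_diff[OF wL2 g]])
      (simp add: primitive_diff[OF wL2 g]
        eq_primitive_of_weak_deriv[OF w continuous_on_primitive[OF g] primitive_zero, symmetric])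
  then show "AE x in unit_measure. ?w x = g x" by simp
qed

lemma inner_V_primitive:
  assumes "g \<in> L2" "h \<in> L2"
  shows "inner_V (primitive g) (primitive h) = (\<integral>x. g x * h x \<partial>unit_measure)"
  unfolding inner_V_def
proof (rule integral_cong_AE)
  show "AE x in unit_measure. weak_deriv (primitive g) x * weak_deriv (primitive h) x = g x * h x"
    using weak_deriv_primitive(2)[OF assms(1)] weak_deriv_primitive(2)[OF assms(2)]
    by eventually_elim simp
qed (intro borel_measurable_times L2_measurable weak_deriv_primitive(1) assms)+

lemma V_L2: "u \<in> V \<Longrightarrow> u \<in> L2"
  by (auto simp: V_def intro: continuous_on_L2)

lemma V_diff:
  assumes "u \<in> V" "v \<in> V"
  shows "(\<lambda>x. u x - v x) \<in> V"
proof -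
  obtain g h where "g \<in> L2" "u = primitive g" "h \<in> L2" "v = primitive h"
    using assms by (metis V_cases)
  then have "(\<lambda>x. u x - v x) = primitive (\<lambda>x. g x - h x)" "(\<lambda>x. g x - h x) \<in> L2"
    using primitive_diff L2_diff by auto
  then show ?thesis using V_eq_primitives by auto
qed

lemma inner_V_diff_left:
  assumes "u \<in> V" "v \<in> V" "q \<in> V"
  shows "inner_V (\<lambda>x. u x - v x) q = inner_V u q - inner_V v q"
proof -
  obtain g where g: "g \<in> L2" "u = primitive g" using assms(1) by (rule V_cases)
  obtain h where h: "h \<in> L2" "v = primitive h" using assms(2) by (rule V_cases)
  obtain k where k: "k \<in> L2" "q = primitive k" using assms(3) by (rule V_cases)
  have "(\<lambda>x. u x - v x) = primitive (\<lambda>x. g x - h x)"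
    using primitive_diff[OF g(1) h(1)] g h by auto
  then show ?thesis
    using L2_integrable_mult[OF g(1) k(1)] L2_integrable_mult[OF h(1) k(1)]
    by (simp add: inner_V_primitive L2_diff g h k left_diff_distrib)
qed

lemma V_power2_le_inner_V:
  assumes "u \<in> V"
  shows "(u x)\<^sup>2 \<le> inner_V u u"
proof -
  obtain g where g: "g \<in> L2" "u = primitive g" using assms by (rule V_cases)
  then show ?thesis
    using primitive_power2_le[of g x] inner_V_primitive[of g g] by (simp add: power2_eq_square)
qed

lemma Poincare_V:
  assumes "u \<in> V"
  shows "(\<integral>x. (u x)\<^sup>2 \<partial>unit_measure) \<le> inner_V u u"
proof -
  have "(\<integral>x. (u x)\<^sup>2 \<partial>unit_measure) \<le> (\<integral>x. inner_V u u \<partial>unit_measure)"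
    using V_L2[OF assms] L2_integrable[OF L2_const] V_power2_le_inner_V[OF assms]
    by (intro integral_mono) (simp_all add: L2_def del: integrable_const)
  then show ?thesis by (simp only: integral_unit_measure_const)
qed

section \<open>Solving the variational problem\<close>

lemma point_evaluation_representable:
  "\<exists>E\<in>L2. \<forall>h\<in>L2. primitive h b = (\<integral>t. E t * h t \<partial>unit_measure)"
proof (cases "b \<in> {0..1}")
  case True
  then show ?thesis
    by (intro bexI[of _ "indicator {..<b}"]) (simp_all add: primitive_def L2_indicator)
next
  case False
  then show ?thesis
    by (intro bexI[of _ "\<lambda>t. 0"]) (auto simp: primitive_def L2_const)
qed

text \<open>The base case is Fubini's theorem: \<open>F\<close> acts through its tail integral \<open>G t = \<integral>\<^sub>t\<^sup>1 F\<close>. Each point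
load adds a multiple of the function representing point evaluation.\<close>
lemma load_representable:
  assumes "finite A" and F: "F \<in> L2"
  shows "\<exists>G\<in>L2. \<forall>h\<in>L2. (\<integral>x. F x * primitive h x \<partial>unit_measure) + (\<Sum>b\<in>A. f b * primitive h b)
           = (\<integral>t. G t * h t \<partial>unit_measure)"
  using assms(1)
proof (induction A rule: finite_induct)
  case empty
  define G where "G = (\<lambda>t. \<integral>x. indicator {t<..} x * F x \<partial>unit_measure)"
  note Fint = L2_integrable[OF F]
  have G: "G t = (\<integral>x. F x \<partial>unit_measure) - (\<integral>x. indicator {..<t} x * F x \<partial>unit_measure)" for t
  proof -
    have ints: "integrable unit_measure (\<lambda>x. indicator {..<t} x * F x)"
      "integrable unit_measure (\<lambda>x. indicator {t<..} x * F x)"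
      by (intro L2_integrable L2_indicator_mult F; simp)+
    have "(\<integral>x. F x \<partial>unit_measure)
        = (\<integral>x. indicator {..<t} x * F x + indicator {t<..} x * F x \<partial>unit_measure)"
    proof (rule integral_cong_AE)
      show "AE x in unit_measure. F x = indicator {..<t} x * F x + indicator {t<..} x * F x"
        using AE_unit_neq[of t] by eventually_elim (auto simp: indicator_def)
    qed (use ints Fint in auto)
    then show ?thesis using ints by (simp add: G_def)
  qed
  \<comment> \<open>The tail integral is continuous, in particular square-integrable.\<close>
  have "continuous_on {0..1} (\<lambda>t. (\<integral>x. F x \<partial>unit_measure) - primitive F t)"
    by (intro continuous_intros continuous_on_primitive F)
  then have "continuous_on {0..1} G"
    by (rule continuous_on_eq) (simp add: G primitive_def)
  then have "G \<in> L2" by (rule continuous_on_L2)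
  moreover have "(\<integral>x. F x * primitive h x \<partial>unit_measure) = (\<integral>t. G t * h t \<partial>unit_measure)"
    if "h \<in> L2" for h
  proof -
    have "(\<integral>x. F x * primitive h x \<partial>unit_measure)
        = (\<integral>x. F x * (\<integral>t. indicator {..<x} t * h t \<partial>unit_measure) \<partial>unit_measure)"
      by (rule Bochner_Integration.integral_cong) (auto simp: primitive_def)
    also have "\<dots> = (\<integral>t. h t * G t \<partial>unit_measure)"
      unfolding G_def by (intro Fubini_triangle L2_integrable F that)
    finally show ?thesis by (simp add: mult.commute)
  qed
  ultimately show ?case by auto
next
  case (insert b A)
  then obtain G where G: "G \<in> L2" and rep: "\<And>h. h \<in> L2 \<Longrightarrow>
      (\<integral>x. F x * primitive h x \<partial>unit_measure) + (\<Sum>b\<in>A. f b * primitive h b)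
      = (\<integral>t. G t * h t \<partial>unit_measure)" by blast
  obtain E where E: "E \<in> L2" and ev: "\<And>h. h \<in> L2 \<Longrightarrow> primitive h b = (\<integral>t. E t * h t \<partial>unit_measure)"
    using point_evaluation_representable by blast
  show ?case
  proof (intro bexI ballI)
    show "(\<lambda>t. G t + f b * E t) \<in> L2" by (intro L2_add L2_cmult G E)
    fix h assume h: "h \<in> L2"
    have "(\<integral>t. (G t + f b * E t) * h t \<partial>unit_measure) = (\<integral>t. G t * h t + f b * (E t * h t) \<partial>unit_measure)"
      by (simp add: distrib_right mult.assoc)
    also have "\<dots> = (\<integral>t. G t * h t \<partial>unit_measure) + f b * (\<integral>t. E t * h t \<partial>unit_measure)"
      using L2_integrable_mult[OF G h] L2_integrable_mult[OF E h] by simp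
    finally show "(\<integral>x. F x * primitive h x \<partial>unit_measure) + (\<Sum>b\<in>insert b A. f b * primitive h b)
        = (\<integral>t. (G t + f b * E t) * h t \<partial>unit_measure)"
      using insert rep[OF h] ev[OF h] by simp
  qed
qed

text \<open>Induction on the set of penalised points. Let \<open>g\<close> solve the problem on \<open>A\<close> for \<open>G\<close>, and \<open>w\<close> the
one whose right-hand side is evaluation at the new point \<open>b\<close>. Then \<open>g - s w\<close> misses the right-hand
side by \<open>-s\<close> times evaluation at \<open>b\<close>, and this is compensated by the new penalty term if
\<open>s = \<beta> (g - s w)(b)\<close>, evaluated on primitives. This linear equation for \<open>s\<close> is solvable since the
primitive of \<open>w\<close> at \<open>b\<close> equals the energy of \<open>w\<close> and so is nonnegative.\<close>
lemma point_penalty_solvable: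
  assumes "finite A" "\<beta> > 0" "G \<in> L2"
  shows "\<exists>g\<in>L2. \<forall>h\<in>L2. (\<integral>t. g t * h t \<partial>unit_measure) + \<beta> * (\<Sum>b\<in>A. primitive g b * primitive h b)
           = (\<integral>t. G t * h t \<partial>unit_measure)"
  using assms(1,3)
proof (induction A arbitrary: G rule: finite_induct)
  case empty
  then show ?case by auto
next
  case (insert b A)
  define a where "a = (\<lambda>g h. (\<integral>t. g t * h t \<partial>unit_measure) + \<beta> * (\<Sum>b\<in>A. primitive g b * primitive h b))"
  obtain E where E: "E \<in> L2" and ev: "\<And>h. h \<in> L2 \<Longrightarrow> primitive h b = (\<integral>t. E t * h t \<partial>unit_measure)"
    using point_evaluation_representable by blast
  obtain g where g: "g \<in> L2" and ag: "\<And>h. h \<in> L2 \<Longrightarrow> a g h = (\<integral>t. G t * h t \<partial>unit_measure)"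
    unfolding a_def using insert.IH[OF insert.prems] by blast
  obtain w where w: "w \<in> L2" and aw: "\<And>h. h \<in> L2 \<Longrightarrow> a w h = primitive h b"
    unfolding a_def using insert.IH[OF E] ev by metis
  have "0 \<le> a w w"
    unfolding a_def using \<open>\<beta> > 0\<close>
    by (simp add: power2_eq_square[symmetric] sum_nonneg)
  then have pos: "0 < 1 + \<beta> * primitive w b"
    using aw[OF w] \<open>\<beta> > 0\<close> by (simp add: add_pos_nonneg)
  define s where "s = \<beta> * primitive g b / (1 + \<beta> * primitive w b)"
  define k where "k = (\<lambda>x. g x - s * w x)"
  have s: "s = \<beta> * (primitive g b - s * primitive w b)"
    using pos by (simp add: s_def field_simps)
  have k: "k \<in> L2" unfolding k_def by (intro L2_diff L2_cmult g w)
  have pk: "primitive k x = primitive g x - s * primitive w x" for x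
    unfolding k_def by (simp add: primitive_diff[OF g L2_cmult[OF w]] primitive_cmult)
  have "(\<integral>t. k t * h t \<partial>unit_measure) + \<beta> * (\<Sum>c\<in>insert b A. primitive k c * primitive h c)
      = (\<integral>t. G t * h t \<partial>unit_measure)" if h: "h \<in> L2" for h
  proof -
    have "(\<integral>t. k t * h t \<partial>unit_measure) = (\<integral>t. g t * h t - s * (w t * h t) \<partial>unit_measure)"
      by (simp add: k_def left_diff_distrib mult.assoc)
    also have "\<dots> = (\<integral>t. g t * h t \<partial>unit_measure) - s * (\<integral>t. w t * h t \<partial>unit_measure)"
      using L2_integrable_mult[OF g h] L2_integrable_mult[OF w h] by simp
    finally have int: "(\<integral>t. k t * h t \<partial>unit_measure)
        = (\<integral>t. g t * h t \<partial>unit_measure) - s * (\<integral>t. w t * h t \<partial>unit_measure)" .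
    have sum: "(\<Sum>c\<in>A. primitive k c * primitive h c)
        = (\<Sum>c\<in>A. primitive g c * primitive h c) - s * (\<Sum>c\<in>A. primitive w c * primitive h c)"
      by (simp add: pk left_diff_distrib sum_subtractf sum_distrib_left mult.assoc)
    have "a k h = a g h - s * a w h"
      unfolding a_def int sum by (simp add: algebra_simps)
    also have "\<dots> = (\<integral>t. G t * h t \<partial>unit_measure) - \<beta> * (primitive k b * primitive h b)"
      using s ag[OF h] aw[OF h] by (simp add: pk)
    finally show ?thesis
      using insert.hyps by (simp add: a_def distrib_left)
  qed
  then show ?case using k by blast
qed

lemma solution_exists:
  assumes "finite A" "\<beta> > 0" "F \<in> L2"
  shows "\<exists>p. is_solution \<beta> A (F, f) p"
proof -
  obtain G where G: "G \<in> L2" and rep: "\<And>h. h \<in> L2 \<Longrightarrow>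
      (\<integral>x. F x * primitive h x \<partial>unit_measure) + (\<Sum>b\<in>A. f b * primitive h b)
      = (\<integral>t. G t * h t \<partial>unit_measure)"
    using load_representable[OF assms(1,3)] by blast
  obtain g where g: "g \<in> L2" and sol: "\<And>h. h \<in> L2 \<Longrightarrow>
      (\<integral>t. g t * h t \<partial>unit_measure) + \<beta> * (\<Sum>b\<in>A. primitive g b * primitive h b)
      = (\<integral>t. G t * h t \<partial>unit_measure)"
    using point_penalty_solvable[OF assms(1,2) G] by blast
  have "is_solution \<beta> A (F, f) (primitive g)"
    unfolding is_solution_def V_eq_primitives using g rep sol by (auto simp: inner_V_primitive)
  then show ?thesis by blast
qed

lemma solution_diff:
  assumes p: "is_solution \<beta> A (F, f) p" and r: "is_solution \<beta> A (G, g) r" and FG: "F \<in> L2" "G \<in> L2"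
  shows "is_solution \<beta> A (\<lambda>x. F x - G x, \<lambda>b. f b - g b) (\<lambda>x. p x - r x)"
  unfolding is_solution_def split
proof (intro conjI ballI)
  have V: "p \<in> V" "r \<in> V" using p r by (auto simp: is_solution_def)
  then show "(\<lambda>x. p x - r x) \<in> V" by (rule V_diff)
  fix q assume q: "q \<in> V"
  note qL2 = V_L2[OF q]
  have "(\<integral>x. (F x - G x) * q x \<partial>unit_measure) = (\<integral>x. F x * q x \<partial>unit_measure) - (\<integral>x. G x * q x \<partial>unit_measure)"
    using L2_integrable_mult[OF FG(1) qL2] L2_integrable_mult[OF FG(2) qL2]
    by (simp add: left_diff_distrib)
  moreover have "inner_V p q + \<beta> * (\<Sum>b\<in>A. p b * q b) = (\<integral>x. F x * q x \<partial>unit_measure) + (\<Sum>b\<in>A. f b * q b)"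
    "inner_V r q + \<beta> * (\<Sum>b\<in>A. r b * q b) = (\<integral>x. G x * q x \<partial>unit_measure) + (\<Sum>b\<in>A. g b * q b)"
    using p r q by (auto simp: is_solution_def)
  ultimately show "inner_V (\<lambda>x. p x - r x) q + \<beta> * (\<Sum>b\<in>A. (p b - r b) * q b)
      = (\<integral>x. (F x - G x) * q x \<partial>unit_measure) + (\<Sum>b\<in>A. (f b - g b) * q b)"
    using inner_V_diff_left[OF V q] by (simp add: left_diff_distrib sum_subtractf right_diff_distrib)
qed

lemma norm_L2_power2: "(norm_L2 F)\<^sup>2 = (\<integral>x. (F x)\<^sup>2 \<partial>unit_measure)"
  by (simp add: norm_L2_def)

lemma inner_V_nonneg: "inner_V u u \<ge> 0"
  by (simp add: inner_V_def)

section \<open>Energy estimate and well-posedness\<close>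

text \<open>Testing with \<open>q = p\<close>; Young's inequality is applied separately to the integral and to the sum,
weighted so that the terms in \<open>p\<close> amount to half of the coercivity bound for the left-hand side.\<close>
lemma energy_estimate:
  assumes \<beta>: "\<beta> > 0" and F: "F \<in> L2" and p: "is_solution \<beta> A (F, f) p"
  shows "(min 1 \<beta>)\<^sup>2 * (inner_V p p + (\<Sum>b\<in>A. (p b)\<^sup>2)) \<le> (norm_L2 F)\<^sup>2 + (\<Sum>b\<in>A. (f b)\<^sup>2)"
proof -
  define m where "m = min 1 \<beta>"
  define P where "P = (\<Sum>b\<in>A. (p b)\<^sup>2)"
  have m: "0 < m" "m \<le> 1" "m \<le> \<beta>" using \<beta> by (auto simp: m_def)
  have V: "p \<in> V" using p by (simp add: is_solution_def)
  have P: "0 \<le> P" unfolding P_def by (intro sum_nonneg) simp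
  have young: "2 * m * (x * y) \<le> x\<^sup>2 + m\<^sup>2 * y\<^sup>2" for x y :: real
    using zero_le_power2[of "x - m * y"] by (simp add: power2_diff power_mult_distrib algebra_simps)
  have "2 * m * (\<integral>x. F x * p x \<partial>unit_measure) = (\<integral>x. 2 * m * (F x * p x) \<partial>unit_measure)"
    by simp
  also have "\<dots> \<le> (\<integral>x. (F x)\<^sup>2 + m\<^sup>2 * (p x)\<^sup>2 \<partial>unit_measure)"
    using L2_integrable_mult[OF F V_L2[OF V]] F V_L2[OF V]
    by (intro integral_mono young) (simp_all add: L2_def)
  also have "\<dots> = (norm_L2 F)\<^sup>2 + m\<^sup>2 * (\<integral>x. (p x)\<^sup>2 \<partial>unit_measure)"
    using F V_L2[OF V] by (simp add: L2_def norm_L2_power2)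
  also have "\<dots> \<le> (norm_L2 F)\<^sup>2 + m\<^sup>2 * inner_V p p"
    using Poincare_V[OF V] by (simp add: mult_left_mono)
  finally have bulk: "2 * m * (\<integral>x. F x * p x \<partial>unit_measure) \<le> (norm_L2 F)\<^sup>2 + m\<^sup>2 * inner_V p p" .
  have "2 * m * (\<Sum>b\<in>A. f b * p b) = (\<Sum>b\<in>A. 2 * m * (f b * p b))"
    by (simp add: sum_distrib_left)
  also have "\<dots> \<le> (\<Sum>b\<in>A. (f b)\<^sup>2 + m\<^sup>2 * (p b)\<^sup>2)" by (intro sum_mono young)
  also have "\<dots> = (\<Sum>b\<in>A. (f b)\<^sup>2) + m\<^sup>2 * P"
    by (simp add: P_def sum.distrib sum_distrib_left)
  finally have points: "2 * m * (\<Sum>b\<in>A. f b * p b) \<le> (\<Sum>b\<in>A. (f b)\<^sup>2) + m\<^sup>2 * P" .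
  have "inner_V p p + \<beta> * (\<Sum>b\<in>A. p b * p b) = (\<integral>x. F x * p x \<partial>unit_measure) + (\<Sum>b\<in>A. f b * p b)"
    using p V by (auto simp: is_solution_def)
  then have test: "inner_V p p + \<beta> * P = (\<integral>x. F x * p x \<partial>unit_measure) + (\<Sum>b\<in>A. f b * p b)"
    by (simp add: P_def power2_eq_square)
  have "m * inner_V p p \<le> 1 * inner_V p p" "m * P \<le> \<beta> * P"
    using m P by (intro mult_right_mono inner_V_nonneg; simp)+
  then have "m * (inner_V p p + P) \<le> inner_V p p + \<beta> * P" by (simp add: distrib_left)
  then have "2 * m * (m * (inner_V p p + P)) \<le> 2 * m * (inner_V p p + \<beta> * P)"
    using m by (intro mult_left_mono) auto
  also have "\<dots> \<le> (norm_L2 F)\<^sup>2 + (\<Sum>b\<in>A. (f b)\<^sup>2) + m\<^sup>2 * (inner_V p p + P)"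
    unfolding test using bulk points by (simp add: distrib_left)
  finally have "m\<^sup>2 * (inner_V p p + P) \<le> (norm_L2 F)\<^sup>2 + (\<Sum>b\<in>A. (f b)\<^sup>2)"
    by (simp add: power2_eq_square mult.assoc)
  then show ?thesis by (simp add: m_def P_def)
qed

text \<open>Any upper bound \<open>D\<close> of the squared data norm is admitted, because \<open>D\<close> will be the full norm on
\<open>\<ell>\<^sup>2(B)\<close> although the problem involves finitely many points only.\<close>
lemma solution_bounds:
  assumes \<beta>: "\<beta> > 0" and F: "F \<in> L2" and p: "is_solution \<beta> A (F, f) p"
    and D: "(norm_L2 F)\<^sup>2 + (\<Sum>b\<in>A. (f b)\<^sup>2) \<le> D"
  shows "norm_V p \<le> 1 / min 1 \<beta> * sqrt D" "sqrt (\<Sum>b\<in>A. (p b)\<^sup>2) \<le> 1 / min 1 \<beta> * sqrt D"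
proof -
  define m where "m = min 1 \<beta>"
  have m: "0 < m" using \<beta> by (simp add: m_def)
  have bound: "sqrt Y \<le> 1 / m * sqrt D" if "Y \<le> inner_V p p + (\<Sum>b\<in>A. (p b)\<^sup>2)" for Y
  proof -
    have "m\<^sup>2 * Y \<le> m\<^sup>2 * (inner_V p p + (\<Sum>b\<in>A. (p b)\<^sup>2))"
      using that by (intro mult_left_mono) auto
    also have "\<dots> \<le> D" using energy_estimate[OF \<beta> F p] D by (simp add: m_def)
    finally have "sqrt (m\<^sup>2 * Y) \<le> sqrt D" by simp
    then have "m * sqrt Y \<le> sqrt D" using m by (simp add: real_sqrt_mult)
    then show ?thesis using m by (simp add: field_simps)
  qed
  show "norm_V p \<le> 1 / min 1 \<beta> * sqrt D"
    unfolding norm_V_def m_def[symmetric] by (rule bound) (simp add: sum_nonneg)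
  show "sqrt (\<Sum>b\<in>A. (p b)\<^sup>2) \<le> 1 / min 1 \<beta> * sqrt D"
    unfolding m_def[symmetric] by (rule bound) (simp add: inner_V_nonneg)
qed

text \<open>Continuous dependence is Lipschitz continuity, with constant \<open>1 / min 1 \<beta>\<close>, and equal data force
equal solutions because the \<open>V\<close>-norm dominates point values.\<close>
lemma well_posed:
  assumes A: "finite A" and \<beta>: "\<beta> > 0"
  shows "well_posed_problem \<beta> A"
proof -
  have stable: "norm_V (\<lambda>x. p x - r x) \<le> 1 / min 1 \<beta> * data_dist A (F, f) (G, g)"
    if "F \<in> L2" "G \<in> L2" "is_solution \<beta> A (F, f) p" "is_solution \<beta> A (G, g) r" for F f G g p r
    using solution_bounds(1)[OF \<beta> L2_diff[OF that(1,2)] solution_diff[OF that(3,4,1,2)] order_refl]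
    by (simp add: data_dist_def)
  have unique: "p = r" if F: "F \<in> L2" and sol: "is_solution \<beta> A (F, f) p" "is_solution \<beta> A (F, f) r"
    for F f p r
  proof
    fix x
    let ?d = "\<lambda>x. p x - r x"
    have V: "?d \<in> V" using V_diff sol by (auto simp: is_solution_def)
    have "norm_V ?d \<le> 0" using stable[OF F F sol] by (simp add: data_dist_def norm_L2_def)
    then have "inner_V ?d ?d \<le> 0" by (simp add: norm_V_def)
    then have "(?d x)\<^sup>2 \<le> 0" using V_power2_le_inner_V[OF V, of x] by linarith
    then show "p x = r x" by simp
  qed
  have "\<exists>!p. is_solution \<beta> A d p" if data: "d \<in> L2 \<times> UNIV" for d
  proof -
    obtain F f where d: "d = (F, f)" "F \<in> L2" using data by auto
    show ?thesis
      using solution_exists[OF A \<beta> d(2), of f] unique[OF d(2)] unfolding d(1) by blast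
  qed
  moreover have "\<exists>\<delta>>0. \<forall>d'\<in>L2 \<times> UNIV. \<forall>r. is_solution \<beta> A d' r \<longrightarrow> data_dist A d d' < \<delta> \<longrightarrow>
      norm_V (\<lambda>x. p x - r x) < \<epsilon>"
    if data: "d \<in> L2 \<times> UNIV" and p: "is_solution \<beta> A d p" and "\<epsilon> > 0" for d p \<epsilon>
  proof (intro exI conjI ballI allI impI)
    show "0 < min 1 \<beta> * \<epsilon>" using \<beta> \<open>\<epsilon> > 0\<close> by simp
    fix d' r assume d': "d' \<in> L2 \<times> UNIV" "is_solution \<beta> A d' r" "data_dist A d d' < min 1 \<beta> * \<epsilon>"
    obtain F f where d: "d = (F, f)" "F \<in> L2" using data by auto
    obtain G g where g: "d' = (G, g)" "G \<in> L2" using d'(1) by auto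
    have "norm_V (\<lambda>x. p x - r x) \<le> 1 / min 1 \<beta> * data_dist A d d'"
      using stable[OF d(2) g(2)] p d'(2) d(1) g(1) by simp
    also have "\<dots> < 1 / min 1 \<beta> * (min 1 \<beta> * \<epsilon>)"
      using \<beta> d'(3) by (intro mult_strict_left_mono) auto
    also have "\<dots> = \<epsilon>" using \<beta> by simp
    finally show "norm_V (\<lambda>x. p x - r x) < \<epsilon>" .
  qed
  ultimately show ?thesis
    unfolding well_posed_problem_def hadamard_well_posed_def by blast
qed

theorem theorem2:
  fixes B :: "real set" and Bn :: "nat \<Rightarrow> real set"
    and F f :: "real \<Rightarrow> real" and \<beta> :: real
  assumes "fractal_microstructure B"
    and "sigma_finite_development B Bn"
    and "F \<in> L2"
    and "\<beta> > 0"
  shows "(\<forall>n. well_posed_problem \<beta> (Bn n)) \<and>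
    (f \<in> ell2 B \<longrightarrow>
      (\<forall>p :: nat \<Rightarrow> real \<Rightarrow> real. (\<forall>n. is_solution \<beta> (Bn n) (F, f) (p n)) \<longrightarrow>
        (\<exists>C. \<forall>n. norm_V (p n) \<le> C) \<and>
        (\<forall>n. norm_V (p n) \<le> 1 / min 1 \<beta> * sqrt ((norm_L2 F)\<^sup>2 + (norm_ell2 B f)\<^sup>2) \<and>
             sqrt (\<Sum>b\<in>Bn n. (p n b)\<^sup>2)
               \<le> 1 / min 1 \<beta> * sqrt ((norm_L2 F)\<^sup>2 + (norm_ell2 B f)\<^sup>2))))"
proof -
  let ?C = "1 / min 1 \<beta> * sqrt ((norm_L2 F)\<^sup>2 + (norm_ell2 B f)\<^sup>2)"
  have Bn: "finite (Bn n)" "Bn n \<subseteq> B" for n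
    using assms(2) by (auto simp: sigma_finite_development_def)
  have "norm_V (p n) \<le> ?C \<and> sqrt (\<Sum>b\<in>Bn n. (p n b)\<^sup>2) \<le> ?C"
    if f: "f \<in> ell2 B" and p: "\<forall>n. is_solution \<beta> (Bn n) (F, f) (p n)" for p n
  proof -
    have "(\<Sum>b\<in>Bn n. \<bar>f b\<bar>\<^sup>2) \<le> (\<Sum>\<^sub>\<infinity>b\<in>B. \<bar>f b\<bar>\<^sup>2)"
      by (rule finite_sum_le_infsum) (use f Bn in \<open>auto simp: ell2_def\<close>)
    also have "\<dots> = (norm_ell2 B f)\<^sup>2"
      by (simp add: norm_ell2_def infsum_nonneg)
    finally have data: "(norm_L2 F)\<^sup>2 + (\<Sum>b\<in>Bn n. (f b)\<^sup>2) \<le> (norm_L2 F)\<^sup>2 + (norm_ell2 B f)\<^sup>2"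
      by simp
    show ?thesis
      using solution_bounds[OF assms(4,3) p[rule_format] data] by (rule conjI)
  qed
  then show ?thesis using well_posed[OF Bn(1) assms(4)] by blast
qed

end
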